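(* Let $a=\{a(k)\}_{k\in\mathbb{Z}}$ be a real sequence with $a\in\ell^1(\mathbb{Z})$. Then for every real $\lambda>0$, $$\bigl|\{m\in\mathbb{Z}: M'a(m)>4\lambda\}\bigr|\ \le\ 3\,\bigl|\{m\in\mathbb{Z}: M_d a(m)>\lambda\}\bigr|,$$ where $M'$ is the centered Hardy-Littlewood maximal operator and $M_d$ is the dyadic Hardy-Littlewood maximal operator.
   Context: For a subset $S\subset\mathbb{Z}$, $|S|$ denotes its cardinality. The dyadic intervals in $\mathbb{Z}$ are the sets $I_{N,j}=\{(j-1)2^N+1,\dots,j2^N\}$ with $N$ a positive integer ($N\ge 1$) and $j\in\mathbb{Z}$. For a real sequence $a$ and $m\in\mathbb{Z}$ define: Centered Hardy-Littlewood maximal operator: $M'a(m)=\sup_{r\ge 1}\frac{1}{2r+1}\sum_{n=-r}^{r}|a(m-n)|$, the supremum being over positive integers $r$. Dyadic Hardy-Littlewood maximal operator: $M_d a(m)=\sup_{I\ni m}\frac{1}{|I|}\sum_{k\in I}|a(k)|$, the supremum being over all dyadic intervals $I$ containing $m$. *)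

theory Defs
  imports "HOL-Analysis.Analysis"
begin

definition dyadic_interval :: "nat \<Rightarrow> int \<Rightarrow> int set" where
  "dyadic_interval N j = {(j - 1) * 2 ^ N + 1 .. j * 2 ^ N}"

definition dyadic_intervals :: "int set set" where
  "dyadic_intervals = {dyadic_interval N j | N j. N \<ge> 1}"

text \<open>The maximal operators take values in the extended reals, because the suprema may be
  infinite for a general real sequence.\<close>

definition centered_maximal :: "(int \<Rightarrow> real) \<Rightarrow> int \<Rightarrow> ereal" where
  "centered_maximal a m =
     (SUP r\<in>{1::nat..}. ereal (1 / (2 * real r + 1) * (\<Sum>n = - int r..int r. \<bar>a (m - n)\<bar>)))"

definition dyadic_maximal :: "(int \<Rightarrow> real) \<Rightarrow> int \<Rightarrow> ereal" where
  "dyadic_maximal a m =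
     (SUP I\<in>{I \<in> dyadic_intervals. m \<in> I}. ereal (1 / real (card I) * (\<Sum>k\<in>I. \<bar>a k\<bar>)))"

text \<open>Cardinality is taken in \<open>[0, \<infinity>]\<close>, with value \<open>\<infinity>\<close> on infinite sets, whereas
  \<^const>\<open>card\<close> is \<open>0\<close> there.\<close>

abbreviation cardinality :: "int set \<Rightarrow> ennreal" where
  "cardinality S \<equiv> emeasure (count_space UNIV) S"

end

theory Submission imports Defs begin

text \<open>Call a dyadic interval heavy if its average exceeds \<open>\<lambda>\<close>; the set where the dyadic maximal
  function exceeds \<open>\<lambda>\<close> is the union of the heavy intervals. If it is infinite there is nothing to
  prove. Otherwise there are finitely many heavy intervals, the maximal ones are disjoint with the
  same union, and it suffices that their threefold dilations cover the set where the centered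
  maximal function exceeds \<open>4\<lambda>\<close>. Indeed, if \<open>2\<^sup>N\<close> is the least power of two above \<open>2r + 1\<close>, a centered
  interval of radius \<open>r\<close> around \<open>m\<close> is covered by two neighbouring dyadic intervals of length
  \<open>2\<^sup>N \<le> 2(2r + 1)\<close>; if the average over it exceeds \<open>4\<lambda>\<close>, one of the two is heavy, and \<open>m\<close> lies in
  its dilation.\<close>

text \<open>This is the threefold dilation when \<open>I\<close> is an interval; the formulation is chosen because it is
  evidently monotone in \<open>I\<close>.\<close>

definition dilate :: "int set \<Rightarrow> int set" where
  "dilate I = {m. \<exists>k\<in>I. \<bar>m - k\<bar> \<le> int (card I)}"

lemma dilate_mono: "I \<subseteq> J \<Longrightarrow> finite J \<Longrightarrow> dilate I \<subseteq> dilate J"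
  unfolding dilate_def by (auto intro!: bexI dest: card_mono)

lemma int_div_eq_iff:
  fixes k d q :: int
  assumes "d > 0"
  shows "k div d = q \<longleftrightarrow> q * d \<le> k \<and> k < (q + 1) * d"
proof
  assume "k div d = q"
  then show "q * d \<le> k \<and> k < (q + 1) * d"
    using div_mult_mod_eq[of k d] pos_mod_bound[OF assms, of k] pos_mod_sign[OF assms, of k]
    by (simp only: distrib_right) linarith
next
  assume "q * d \<le> k \<and> k < (q + 1) * d"
  then show "k div d = q"
    by (intro int_div_pos_eq[where r = "k - q * d"]) (auto simp: algebra_simps)
qed

text \<open>The shift by 1 is due to the intervals starting at 1 modulo 2^N. In this form nesting
  becomes a fact about iterated quotients.\<close>

lemma mem_dyadic_interval_iff: "k \<in> dyadic_interval N j \<longleftrightarrow> (k - 1) div 2 ^ N = j - 1"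
  by (auto simp: dyadic_interval_def int_div_eq_iff)

lemma finite_dyadic_interval [simp]: "finite (dyadic_interval N j)"
  by (simp add: dyadic_interval_def)

lemma card_dyadic_interval [simp]: "card (dyadic_interval N j) = 2 ^ N"
  by (simp add: dyadic_interval_def algebra_simps nat_power_eq)

lemma dilate_dyadic_interval:
  "dilate (dyadic_interval N j) = {(j - 2) * 2 ^ N + 1 .. (j + 1) * 2 ^ N}"
proof -
  define L :: int where "L = 2 ^ N"
  define x where "x = (j - 1) * L"
  have "L \<ge> 1" by (simp add: L_def)
  have "(\<exists>k\<in>{x + 1..x + L}. \<bar>m - k\<bar> \<le> L) \<longleftrightarrow> x - L + 1 \<le> m \<and> m \<le> x + 2 * L" for m
  proof
    assume "x - L + 1 \<le> m \<and> m \<le> x + 2 * L"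
    with \<open>L \<ge> 1\<close> show "\<exists>k\<in>{x + 1..x + L}. \<bar>m - k\<bar> \<le> L"
      \<comment> \<open>The witness is the point of the interval nearest to
        \<open>m\<close>.\<close>
      by (intro bexI[of _ "max (x + 1) (min (x + L) m)"]) auto
  qed auto
  then show ?thesis
    unfolding dilate_def card_dyadic_interval
    by (auto simp: dyadic_interval_def x_def L_def algebra_simps)
qed

text \<open>The quotient by the larger power is a function of the quotient by the smaller one, so
  points sharing a fine interval share the coarse one.\<close>

lemma dyadic_interval_nested:
  assumes "N \<le> N'" "dyadic_interval N j \<inter> dyadic_interval N' j' \<noteq> {}"
  shows "dyadic_interval N j \<subseteq> dyadic_interval N' j'"
proof -
  have "(k - 1) div 2 ^ N' = (k - 1) div 2 ^ N div (2 ^ (N' - N) :: int)" for k :: int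
    using assms(1) by (simp flip: zdiv_zmult2_eq power_add)
  with assms(2) show ?thesis by (auto simp: mem_dyadic_interval_iff)
qed

lemma dyadic_intervals_nested:
  assumes "I \<in> dyadic_intervals" "J \<in> dyadic_intervals" "I \<inter> J \<noteq> {}"
  shows "I \<subseteq> J \<or> J \<subseteq> I"
proof -
  from assms(1,2) obtain N j N' j' where "I = dyadic_interval N j" "J = dyadic_interval N' j'"
    by (auto simp: dyadic_intervals_def)
  with assms(3) show ?thesis
    using dyadic_interval_nested[of N N' j j'] dyadic_interval_nested[of N' N j' j]
    by (cases "N \<le> N'") (auto simp: Int_commute)
qed

definition heavy_intervals :: "(int \<Rightarrow> real) \<Rightarrow> real \<Rightarrow> int set set" where
  "heavy_intervals a lam = {I \<in> dyadic_intervals. lam * real (card I) < (\<Sum>k\<in>I. \<bar>a k\<bar>)}"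

text \<open>Anything strictly below a supremum is exceeded by some member, and one heavy interval
  serves as witness for all its points.\<close>

lemma dyadic_maximal_superlevel: "{m. dyadic_maximal a m > ereal lam} = \<Union>(heavy_intervals a lam)"
  unfolding dyadic_maximal_def less_SUP_iff heavy_intervals_def
  by (force simp: dyadic_intervals_def field_simps)

lemma centered_superlevel_heavy:
  assumes "centered_maximal a m > ereal (4 * lam)" "lam > 0"
  shows "\<exists>I\<in>heavy_intervals a lam. m \<in> dilate I"
proof -
  from assms(1) obtain r :: nat where r: "r \<ge> 1"
    and avg: "4 * lam < 1 / (2 * real r + 1) * (\<Sum>n = - int r..int r. \<bar>a (m - n)\<bar>)"
    unfolding centered_maximal_def less_SUP_iff by auto
  have "(\<Sum>n = - int r..int r. \<bar>a (m - n)\<bar>) = (\<Sum>k = m - int r..m + int r. \<bar>a k\<bar>)"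
    by (rule sum.reindex_bij_witness[of _ "\<lambda>k. m - k" "\<lambda>n. m - n"]) auto
  with avg have big: "4 * lam * (2 * real r + 1) < (\<Sum>k = m - int r..m + int r. \<bar>a k\<bar>)"
    by (simp add: field_simps)
  obtain n where "2 ^ n \<le> 2 * r + 1" "2 * r + 1 < 2 ^ (n + 1)"
    using ex_power_ivl1[of 2 "2 * r + 1"] by auto
  then obtain N where N: "N \<ge> 1" "2 ^ N \<le> 2 * (2 * r + 1)" "2 * r + 1 < 2 ^ N"
    by (intro that[of "n + 1"]) auto
  then have N_real: "2 ^ N \<le> 2 * (2 * real r + 1)" and N_int: "2 * int r + 1 < 2 ^ N"
    using of_nat_mono[of "2 ^ N" "2 * (2 * r + 1)", where 'a = real]
      of_nat_less_iff[of "2 * r + 1" "2 ^ N", where 'a = int] by simp_all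
  \<comment> \<open>The left end \<open>m - int r\<close> lies in interval \<open>p + 1\<close>, and
    a window of fewer than 2^N points cannot reach past interval \<open>p + 2\<close>. As
    \<open>m\<close> is in one of these neighbours, it is in both dilations.\<close>
  define p where "p = (m - int r - 1) div 2 ^ N"
  define R where "R = (\<lambda>j. dyadic_interval N j)"
  have "p * 2 ^ N \<le> m - int r - 1" "m - int r - 1 < (p + 1) * 2 ^ N"
    using int_div_eq_iff[of "2 ^ N" "m - int r - 1" p] by (simp_all add: p_def)
  with N_int have cover: "{m - int r..m + int r} \<subseteq> R (p + 1) \<union> R (p + 2)"
    and dil: "m \<in> dilate (R (p + 1))" "m \<in> dilate (R (p + 2))"
    unfolding R_def dilate_dyadic_interval
    by (auto simp: dyadic_interval_def algebra_simps)
  have "R (p + 1) \<in> heavy_intervals a lam \<or> R (p + 2) \<in> heavy_intervals a lam"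
  proof (rule ccontr)
    assume "\<not> ?thesis"
    moreover have "R j \<in> dyadic_intervals" for j
      using N(1) by (auto simp: R_def dyadic_intervals_def)
    ultimately have light: "(\<Sum>k\<in>R j. \<bar>a k\<bar>) \<le> lam * 2 ^ N" if "j \<in> {p + 1, p + 2}" for j
      using that by (auto simp: heavy_intervals_def R_def not_less)
    have "(\<Sum>k = m - int r..m + int r. \<bar>a k\<bar>) \<le> (\<Sum>k\<in>R (p + 1) \<union> R (p + 2). \<bar>a k\<bar>)"
      using cover by (intro sum_mono2) (auto simp: R_def)
    also have "\<dots> \<le> (\<Sum>k\<in>R (p + 1). \<bar>a k\<bar>) + (\<Sum>k\<in>R (p + 2). \<bar>a k\<bar>)"
      by (subst sum_Un) (auto simp: R_def intro!: sum_nonneg)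
    \<comment> \<open>The factor 4 arises here: two light intervals, each of length at most twice
      that of the window.\<close>
    also have "\<dots> \<le> 2 * lam * 2 ^ N"
      using light[of "p + 1"] light[of "p + 2"] by simp
    also have "\<dots> \<le> 2 * lam * (2 * (2 * real r + 1))"
      using N_real assms(2) by (intro mult_left_mono) auto
    finally show False using big by (simp add: algebra_simps)
  qed
  with dil show ?thesis by blast
qed

theorem theorem4p2:
  fixes a :: "int \<Rightarrow> real" and lam :: real
  assumes "(\<lambda>k. \<bar>a k\<bar>) summable_on UNIV"
    and "lam > 0"
  shows "cardinality {m. centered_maximal a m > ereal (4 * lam)}
         \<le> 3 * cardinality {m. dyadic_maximal a m > ereal lam}"
proof -
  define G where "G = heavy_intervals a lam"
  define C where "C = {m. centered_maximal a m > ereal (4 * lam)}"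
  have G_dyadic: "G \<subseteq> dyadic_intervals" by (auto simp: G_def heavy_intervals_def)
  have "cardinality C \<le> 3 * cardinality (\<Union>G)"
  proof (cases "finite (\<Union>G)")
    case False
    then show ?thesis by (simp add: ennreal_mult_top)
  next
    case True
    \<comment> \<open>All members of \<open>G\<close> are subsets of one finite set.\<close>
    then have "finite G" by (rule finite_UnionD)
    define M where "M = {I \<in> G. \<forall>J\<in>G. I \<subseteq> J \<longrightarrow> J = I}"
    have "finite M" and M_dyadic: "M \<subseteq> dyadic_intervals"
      using \<open>finite G\<close> G_dyadic by (auto simp: M_def)
    have fin: "finite I" and card_dil: "finite (dilate I) \<and> card (dilate I) = 3 * card I"
      if "I \<in> M" for I
      using that M_dyadic unfolding dyadic_intervals_def
      by (auto simp: dilate_dyadic_interval algebra_simps nat_mult_distrib nat_power_eq)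
    have above: "\<exists>J\<in>M. I \<subseteq> J" if "I \<in> G" for I
      using finite_has_maximal2[OF \<open>finite G\<close> that] by (auto simp: M_def)
    have "disjoint M"
    proof (rule disjointI)
      fix I J assume IJ: "I \<in> M" "J \<in> M" "I \<noteq> J"
      then have "\<not> I \<subseteq> J" "\<not> J \<subseteq> I" by (auto simp: M_def)
      with IJ show "I \<inter> J = {}"
        using dyadic_intervals_nested[of I J] M_dyadic by blast
    qed
    have "C \<subseteq> (\<Union>I\<in>M. dilate I)"
    proof
      fix m assume "m \<in> C"
      then obtain I where "I \<in> G" "m \<in> dilate I"
        using centered_superlevel_heavy[of lam a m] assms(2) by (auto simp: C_def G_def)
      moreover obtain J where "J \<in> M" "I \<subseteq> J" using above[OF \<open>I \<in> G\<close>] by blast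
      ultimately show "m \<in> (\<Union>I\<in>M. dilate I)" using dilate_mono[OF _ fin] by blast
    qed
    moreover have fin_dil: "finite (\<Union>I\<in>M. dilate I)" using \<open>finite M\<close> card_dil by auto
    \<comment> \<open>Finiteness of \<open>C\<close> is recorded because \<open>card\<close> would
      be 0 on an infinite set and the bound would then say nothing about
      \<open>cardinality\<close>.\<close>
    ultimately have "finite C" and "card C \<le> card (\<Union>I\<in>M. dilate I)"
      by (auto intro: finite_subset card_mono)
    note this(2)
    also have "card (\<Union>I\<in>M. dilate I) \<le> (\<Sum>I\<in>M. card (dilate I))"
      by (rule card_UN_le[OF \<open>finite M\<close>])
    also have "\<dots> = 3 * (\<Sum>I\<in>M. card I)"
      using card_dil by (simp add: sum_distrib_left)
    also have "(\<Sum>I\<in>M. card I) = card (\<Union>M)"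
      using \<open>disjoint M\<close> fin by (intro card_Union_disjoint[symmetric]) auto
    also have "\<dots> \<le> card (\<Union>G)"
      using True by (intro card_mono) (auto simp: M_def)
    finally have "card C \<le> 3 * card (\<Union>G)" by simp
    then have "ennreal (real (card C)) \<le> ennreal (real (3 * card (\<Union>G)))"
      by (intro ennreal_leI) linarith
    then show ?thesis
      using \<open>finite C\<close> True by (simp add: ennreal_mult ennreal_of_nat_eq_real_of_nat)
  qed
  then show ?thesis
    by (simp add: C_def G_def dyadic_maximal_superlevel)
qed

end
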